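(* Let $(X,T,A)$ be a soft $T_{0U}$ topological space. Then $(X,T,A)$ is a soft $T_{(0,0^k)}$ space if and only if for each $x,y\in X$ with $x\not\approx y$, there exists a soft open set $(G,A)$ such that $x\in(G,A)$ and $y\in(G,A)^c$, or there is a soft open set $(F,A)$ such that $y\in(F,A)$ and $x\in(F,A)^c$.
   Context: A soft set over a set $X$ with parameter set $A$ is a pair $(F,A)$ with $F:A\to\mathcal P(X)$; $SS(X)_A$ is the set of all of them. $0_A$ and $1_A$ denote the soft sets with constant value $\emptyset$, respectively $X$. Soft union, soft intersection $\sqcap$, complement $(F,A)^c$ and inclusion $\sqsubseteq$ are defined parameterwise. For $x\in X$, $x\in(F,A)$ means $x\in F(a)$ for all $a\in A$; $x\notin(F,A)$ means $x\notin F(a)$ for some $a\in A$; so $x\in(F,A)^c$ means $x\notin F(a)$ for all $a\in A$. A soft topology on $X$ is a family $T\subseteq SS(X)_A$ containing $0_A,1_A$ and closed under binary soft intersections and arbitrary soft unions; members of $T$ are soft open. A soft neighbourhood of $x$ is a soft set $(F,A)$ such that $x\in(G,A)\sqsubseteq(F,A)$ for some $(G,A)\in T$; $\mathcal U_x$ is the collection of these. Write $x\approx y$ if $x\in(G,A)$ for each $(G,A)\in\mathcal U_y$ and $y\in(F,A)$ for each $(F,A)\in\mathcal U_x$. The space is soft $T_{0U}$ if whenever $x\approx y$, for every $a\in A$ and $(F,A)\in T$: $x\in F(a)$ if and only if $y\in F(a)$. Soft $T_0$ reflection: $X_0$ is the set of equivalence classes of $\approx$ on $X$, $r_X:X\to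 X_0$ the canonical surjection, and $T_0$ is the soft topology on $X_0$ consisting of those $(F,A)\in SS(X_0)_A$ for which the soft set $a\mapsto r_X^{-1}(F(a))$ belongs to $T$; $(X_0,T_0,A)$ is the soft $T_0$ reflection of $(X,T,A)$. A soft topological space is soft $T_{0^k}$ if for all distinct points $x,y$ there is a soft open $(F,A)$ with $x\in(F,A)$, $y\in(F,A)^c$, or a soft open $(G,A)$ with $y\in(G,A)$, $x\in(G,A)^c$. $(X,T,A)$ is soft $T_{(0,0^k)}$ if $(X_0,T_0,A)$ is soft $T_{0^k}$. *)

theory Defs
  imports Main "HOL-Library.FuncSet"
begin

text \<open>
  A soft set over \<open>X\<close> with parameter set \<open>A\<close> is a function from \<open>A\<close> to the power set of \<open>X\<close>.
  It is represented extensionally (undefined outside \<open>A\<close>), so that HOL equality of elements of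
  \<open>soft_sets X A\<close> is equality of soft sets. The operations below are restricted to \<open>A\<close> accordingly.
\<close>

definition soft_sets :: "'x set \<Rightarrow> 'a set \<Rightarrow> ('a \<Rightarrow> 'x set) set" where
  "soft_sets X A = A \<rightarrow>\<^sub>E Pow X"

definition soft_null :: "'a set \<Rightarrow> 'a \<Rightarrow> 'x set" where
  "soft_null A = (\<lambda>a\<in>A. {})"

definition soft_full :: "'x set \<Rightarrow> 'a set \<Rightarrow> 'a \<Rightarrow> 'x set" where
  "soft_full X A = (\<lambda>a\<in>A. X)"

definition soft_inter :: "'a set \<Rightarrow> ('a \<Rightarrow> 'x set) \<Rightarrow> ('a \<Rightarrow> 'x set) \<Rightarrow> 'a \<Rightarrow> 'x set" where
  "soft_inter A F G = (\<lambda>a\<in>A. F a \<inter> G a)"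

definition soft_Union :: "'a set \<Rightarrow> ('a \<Rightarrow> 'x set) set \<Rightarrow> 'a \<Rightarrow> 'x set" where
  "soft_Union A S = (\<lambda>a\<in>A. \<Union>F\<in>S. F a)"

definition soft_compl :: "'x set \<Rightarrow> 'a set \<Rightarrow> ('a \<Rightarrow> 'x set) \<Rightarrow> 'a \<Rightarrow> 'x set" where
  "soft_compl X A F = (\<lambda>a\<in>A. X - F a)"

definition soft_subset :: "'a set \<Rightarrow> ('a \<Rightarrow> 'x set) \<Rightarrow> ('a \<Rightarrow> 'x set) \<Rightarrow> bool" where
  "soft_subset A F G \<longleftrightarrow> (\<forall>a\<in>A. F a \<subseteq> G a)"

definition soft_mem :: "'a set \<Rightarrow> 'x \<Rightarrow> ('a \<Rightarrow> 'x set) \<Rightarrow> bool" where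
  "soft_mem A x F \<longleftrightarrow> (\<forall>a\<in>A. x \<in> F a)"

definition soft_topology :: "'x set \<Rightarrow> 'a set \<Rightarrow> ('a \<Rightarrow> 'x set) set \<Rightarrow> bool" where
  "soft_topology X A T \<longleftrightarrow>
     T \<subseteq> soft_sets X A \<and> soft_null A \<in> T \<and> soft_full X A \<in> T \<and>
     (\<forall>F\<in>T. \<forall>G\<in>T. soft_inter A F G \<in> T) \<and>
     (\<forall>S. S \<subseteq> T \<longrightarrow> soft_Union A S \<in> T)"

definition soft_nbhds :: "'x set \<Rightarrow> 'a set \<Rightarrow> ('a \<Rightarrow> 'x set) set \<Rightarrow> 'x \<Rightarrow> ('a \<Rightarrow> 'x set) set" where
  "soft_nbhds X A T x =
     {F \<in> soft_sets X A. \<exists>G\<in>T. soft_mem A x G \<and> soft_subset A G F}"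

text \<open>The relation \<open>x \<approx> y\<close>; it is only meant for points of \<open>X\<close>.\<close>

definition soft_indist :: "'x set \<Rightarrow> 'a set \<Rightarrow> ('a \<Rightarrow> 'x set) set \<Rightarrow> 'x \<Rightarrow> 'x \<Rightarrow> bool" where
  "soft_indist X A T x y \<longleftrightarrow>
     (\<forall>G\<in>soft_nbhds X A T y. soft_mem A x G) \<and> (\<forall>F\<in>soft_nbhds X A T x. soft_mem A y F)"

definition soft_T0U :: "'x set \<Rightarrow> 'a set \<Rightarrow> ('a \<Rightarrow> 'x set) set \<Rightarrow> bool" where
  "soft_T0U X A T \<longleftrightarrow>
     (\<forall>x\<in>X. \<forall>y\<in>X. soft_indist X A T x y \<longrightarrow>
        (\<forall>a\<in>A. \<forall>F\<in>T. x \<in> F a \<longleftrightarrow> y \<in> F a))"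

definition soft_T0k :: "'x set \<Rightarrow> 'a set \<Rightarrow> ('a \<Rightarrow> 'x set) set \<Rightarrow> bool" where
  "soft_T0k X A T \<longleftrightarrow>
     (\<forall>x\<in>X. \<forall>y\<in>X. x \<noteq> y \<longrightarrow>
        (\<exists>F\<in>T. soft_mem A x F \<and> soft_mem A y (soft_compl X A F)) \<or>
        (\<exists>G\<in>T. soft_mem A y G \<and> soft_mem A x (soft_compl X A G)))"

definition soft_indist_rel :: "'x set \<Rightarrow> 'a set \<Rightarrow> ('a \<Rightarrow> 'x set) set \<Rightarrow> ('x \<times> 'x) set" where
  "soft_indist_rel X A T = {(x, y) \<in> X \<times> X. soft_indist X A T x y}"

text \<open>
  The soft \<open>T\<^sub>0\<close> reflection \<open>(X\<^sub>0, T\<^sub>0, A)\<close> with projection \<open>r\<^sub>X\<close>. Points of \<open>X\<^sub>0\<close> are sets of points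
  of \<open>X\<close>; the preimage under \<open>r\<^sub>X\<close> has to be cut down to the carrier \<open>X\<close>.
\<close>

definition T0_points :: "'x set \<Rightarrow> 'a set \<Rightarrow> ('a \<Rightarrow> 'x set) set \<Rightarrow> 'x set set" where
  "T0_points X A T = X // soft_indist_rel X A T"

definition T0_proj :: "'x set \<Rightarrow> 'a set \<Rightarrow> ('a \<Rightarrow> 'x set) set \<Rightarrow> 'x \<Rightarrow> 'x set" where
  "T0_proj X A T x = soft_indist_rel X A T `` {x}"

definition T0_opens :: "'x set \<Rightarrow> 'a set \<Rightarrow> ('a \<Rightarrow> 'x set) set \<Rightarrow> ('a \<Rightarrow> 'x set set) set" where
  "T0_opens X A T =
     {F \<in> soft_sets (T0_points X A T) A. (\<lambda>a\<in>A. T0_proj X A T -` F a \<inter> X) \<in> T}"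

text \<open>The property \<open>T\<close> with index \<open>(0, 0\<^sup>k)\<close>: the reflection is soft \<open>T\<close> with index \<open>0\<^sup>k\<close>.\<close>

definition soft_T00k :: "'x set \<Rightarrow> 'a set \<Rightarrow> ('a \<Rightarrow> 'x set) set \<Rightarrow> bool" where
  "soft_T00k X A T \<longleftrightarrow> soft_T0k (T0_points X A T) A (T0_opens X A T)"

end

theory Submission
  imports Defs
begin

text \<open>
  Both sides speak of separating two points by an open soft set that contains one of them at every
  parameter and the other at none, once for distinct points of the reflection and once for
  distinguishable points of \<open>X\<close>. Two points of \<open>X\<close> are distinguishable exactly when their classes
  are distinct (\<open>T0_proj_eq_iff\<close>), so it is enough that the projection preserves and reflects this
  separation (\<open>T0_proj_separates_iff\<close>).

  Reflecting it is immediate: an open soft set of the reflection pulls back to an open soft set of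
  \<open>X\<close> by definition of the quotient topology. Preserving it requires pushing an open soft set
  forward, and this is where the hypothesis \<open>T\<^sub>0\<^sub>U\<close> enters: indistinguishability only compares the
  points that lie in an open soft set at all parameters simultaneously, whereas \<open>T\<^sub>0\<^sub>U\<close> makes each
  single value \<open>G a\<close> a union of classes. Hence the image of \<open>G\<close> pulls back to \<open>G\<close> itself, so the
  image is open and contains a class at a given parameter iff \<open>G\<close> contains the representative there.
\<close>

lemma soft_open_subset_carrier:
  assumes "soft_topology X A T" and "F \<in> T" and "a \<in> A"
  shows "F a \<subseteq> X"
  using assms unfolding soft_topology_def soft_sets_def by (blast dest: PiE_mem)

text \<open>
  An open soft set is a soft neighbourhood of each of its points, and conversely every soft
  neighbourhood contains an open one; so neighbourhoods may be replaced by open soft sets. In this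
  form \<open>\<approx>\<close> is visibly an equivalence relation.
\<close>

lemma soft_indist_iff_same_opens:
  assumes "soft_topology X A T"
  shows "soft_indist X A T x y \<longleftrightarrow> (\<forall>F\<in>T. soft_mem A x F \<longleftrightarrow> soft_mem A y F)"
proof -
  have "(\<forall>F\<in>soft_nbhds X A T u. soft_mem A v F) \<longleftrightarrow> (\<forall>F\<in>T. soft_mem A u F \<longrightarrow> soft_mem A v F)" for u v
  proof
    assume nbhds: "\<forall>F\<in>soft_nbhds X A T u. soft_mem A v F"
    have "F \<in> soft_nbhds X A T u" if "F \<in> T" "soft_mem A u F" for F
      using assms that unfolding soft_nbhds_def soft_topology_def soft_subset_def by blast
    with nbhds show "\<forall>F\<in>T. soft_mem A u F \<longrightarrow> soft_mem A v F" by blast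
  next
    assume "\<forall>F\<in>T. soft_mem A u F \<longrightarrow> soft_mem A v F"
    then show "\<forall>F\<in>soft_nbhds X A T u. soft_mem A v F"
      unfolding soft_nbhds_def soft_subset_def soft_mem_def by blast
  qed
  then show ?thesis unfolding soft_indist_def by blast
qed

lemma equiv_soft_indist_rel:
  assumes "soft_topology X A T"
  shows "equiv X (soft_indist_rel X A T)"
  unfolding soft_indist_rel_def soft_indist_iff_same_opens[OF assms]
  by (auto simp: equiv_def refl_on_def sym_def trans_def)

lemma T0_proj_eq_iff:
  assumes "soft_topology X A T" and "x \<in> X" and "y \<in> X"
  shows "T0_proj X A T x = T0_proj X A T y \<longleftrightarrow> soft_indist X A T x y"
  using eq_equiv_class_iff[OF equiv_soft_indist_rel[OF assms(1)] assms(2,3)] assms(2,3)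
  by (simp add: T0_proj_def soft_indist_rel_def)

lemma T0_points_eq_image: "T0_points X A T = T0_proj X A T ` X"
  by (auto simp: T0_points_def T0_proj_def quotient_def)

text \<open>The parameterwise form of \<open>T\<^sub>0\<^sub>U\<close>: each value of an open soft set is a union of classes.\<close>

lemma T0_proj_mem_image_open_iff:
  assumes "soft_topology X A T" and "soft_T0U X A T"
    and "G \<in> T" and "a \<in> A" and "x \<in> X"
  shows "T0_proj X A T x \<in> T0_proj X A T ` G a \<longleftrightarrow> x \<in> G a"
proof
  assume "T0_proj X A T x \<in> T0_proj X A T ` G a"
  then obtain y where y: "y \<in> G a" "T0_proj X A T x = T0_proj X A T y" by blast
  have "y \<in> X" using soft_open_subset_carrier[OF assms(1,3,4)] y(1) by blast
  then have "soft_indist X A T x y" using T0_proj_eq_iff[OF assms(1,5)] y(2) by blast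
  then show "x \<in> G a"
    using assms(2-5) \<open>y \<in> X\<close> y(1) unfolding soft_T0U_def by blast
qed simp

lemma image_in_T0_opens:
  assumes "soft_topology X A T" and "soft_T0U X A T" and "G \<in> T"
  shows "(\<lambda>a\<in>A. T0_proj X A T ` G a) \<in> T0_opens X A T"
proof -
  have "G \<in> extensional A"
    using assms(1,3) unfolding soft_topology_def soft_sets_def by (auto simp: PiE_def)
  moreover have "T0_proj X A T -` (T0_proj X A T ` G a) \<inter> X = G a" if "a \<in> A" for a
    using T0_proj_mem_image_open_iff[OF assms that] soft_open_subset_carrier[OF assms(1,3) that]
    by auto
  ultimately have "(\<lambda>a\<in>A. T0_proj X A T -` ((\<lambda>a\<in>A. T0_proj X A T ` G a) a) \<inter> X) = G"
    by (intro extensionalityI[of _ A]) auto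
  moreover have "(\<lambda>a\<in>A. T0_proj X A T ` G a) \<in> soft_sets (T0_points X A T) A"
    using soft_open_subset_carrier[OF assms(1,3)]
    unfolding soft_sets_def T0_points_eq_image by auto
  ultimately show ?thesis using assms(3) unfolding T0_opens_def by simp
qed

text \<open>
  The two separating soft sets correspond under pullback and direct image; both operations preserve
  membership of a point, respectively of its class, parameter by parameter.
\<close>

lemma T0_proj_separates_iff:
  assumes "soft_topology X A T" and "soft_T0U X A T" and "x \<in> X" and "y \<in> X"
  shows "(\<exists>F\<in>T0_opens X A T. soft_mem A (T0_proj X A T x) F \<and>
            soft_mem A (T0_proj X A T y) (soft_compl (T0_points X A T) A F)) \<longleftrightarrow>
         (\<exists>G\<in>T. soft_mem A x G \<and> soft_mem A y (soft_compl X A G))"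
    (is "?reflection \<longleftrightarrow> ?space")
proof
  assume ?reflection
  then obtain F where F: "F \<in> T0_opens X A T" "soft_mem A (T0_proj X A T x) F"
    "soft_mem A (T0_proj X A T y) (soft_compl (T0_points X A T) A F)" by blast
  let ?G = "\<lambda>a\<in>A. T0_proj X A T -` F a \<inter> X"
  have "?G \<in> T" using F(1) unfolding T0_opens_def by blast
  moreover have "soft_mem A x ?G" "soft_mem A y (soft_compl X A ?G)"
    using F(2,3) assms(3,4) by (auto simp: soft_mem_def soft_compl_def)
  ultimately show ?space by blast
next
  assume ?space
  then obtain G where G: "G \<in> T" "soft_mem A x G" "soft_mem A y (soft_compl X A G)" by blast
  let ?F = "\<lambda>a\<in>A. T0_proj X A T ` G a"
  have "?F \<in> T0_opens X A T" using image_in_T0_opens[OF assms(1,2) G(1)] .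
  moreover have "soft_mem A (T0_proj X A T x) ?F"
    using G(2) by (auto simp: soft_mem_def)
  moreover have "soft_mem A (T0_proj X A T y) (soft_compl (T0_points X A T) A ?F)"
    using G(3) assms(4) T0_proj_mem_image_open_iff[OF assms(1,2) G(1) _ assms(4)]
    by (simp add: soft_mem_def soft_compl_def T0_points_eq_image)
  ultimately show ?reflection by blast
qed

theorem proposition4p2:
  fixes X :: "'x set" and A :: "'a set" and T :: "('a \<Rightarrow> 'x set) set"
  assumes "soft_topology X A T"
    and "soft_T0U X A T"
  shows "soft_T00k X A T \<longleftrightarrow>
    (\<forall>x\<in>X. \<forall>y\<in>X. \<not> soft_indist X A T x y \<longrightarrow>
       (\<exists>G\<in>T. soft_mem A x G \<and> soft_mem A y (soft_compl X A G)) \<or>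
       (\<exists>F\<in>T. soft_mem A y F \<and> soft_mem A x (soft_compl X A F)))"
proof -
  let ?r = "T0_proj X A T"
  let ?sep = "\<lambda>p q. \<exists>F\<in>T0_opens X A T.
    soft_mem A p F \<and> soft_mem A q (soft_compl (T0_points X A T) A F)"
  have "soft_T00k X A T \<longleftrightarrow>
      (\<forall>p\<in>T0_points X A T. \<forall>q\<in>T0_points X A T. p \<noteq> q \<longrightarrow> ?sep p q \<or> ?sep q p)"
    unfolding soft_T00k_def soft_T0k_def ..
  also have "\<dots> \<longleftrightarrow>
      (\<forall>x\<in>X. \<forall>y\<in>X. ?r x \<noteq> ?r y \<longrightarrow> ?sep (?r x) (?r y) \<or> ?sep (?r y) (?r x))"
    by (simp only: T0_points_eq_image ball_simps)
  finally show ?thesis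
    using assms by (simp add: T0_proj_eq_iff T0_proj_separates_iff cong: ball_cong)
qed

end
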